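(* Let $V[p,q]$ be the restriction to $[p,q]$ (where $1\le p\le q\le n$) of a finite-dimensional zigzag module $V$ of length $n$ over a field $K$, with a fixed interval decomposition. Let $J_1=I[b_1,d_1],\dots,J_r=I[b_r,d_r]$ be a breaker chain spanning $[p,q]$. Choose, for each $j$, compatible nonzero generators $x_i^{(j)}\in(J_j)_i$ for $i\in[b_j,d_j]$. For $p\le i\le q$, set $$z_i=\sum_{\substack{1\le j\le r\\ i\in[b_j,d_j]}}x_i^{(j)}\qquad\text{and}\qquad S_i=\operatorname{span}\{z_i\}.$$ Then $S=(S_i)_{p\le i\le q}$ is a submodule of $\bigoplus_{j=1}^rJ_j$ isomorphic to $I[p,q]$, and its inclusion $S\hookrightarrow\bigoplus_{j=1}^rJ_j$ is nonsplitting.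
   Context: Let $K$ be a field. A zigzag module $V$ of length $n$ over $K$ consists of finite-dimensional $K$-vector spaces $V_1,\dots,V_n$ together with, for each $1\le i<n$, exactly one linear map, either $V_i\to V_{i+1}$ (a forward arrow) or $V_i\leftarrow V_{i+1}$ (a backward arrow). The sequence of arrow directions is the zigzag type; it is fixed and all modules compared have the same type. For $p\le q$, the restriction $V[p,q]$ keeps only the vector spaces and arrows with indices between $p$ and $q$. Intervals $[b,d]$ are discrete (sets of integers). The interval module $I[b,d]$ (support $[b,d]$) has $I[b,d]_i=K$ for $b\le i\le d$ and $0$ otherwise, with identity maps between consecutive nonzero spaces and zero maps otherwise. An interval decomposition of $V[p,q]$ is a finite direct sum decomposition into submodules (the interval summands) each isomorphic to an interval module $I[b,d]$ with $p\le b\le d\le q$. A submodule is a family of subspaces preserved by all structure maps. The inclusion of a submodule splits if it admits a retraction, equivalently if the submodule is a direct summand; otherwise it is nonsplitting. Compatible nonzero generators for $J_j$: nonzero vectors $x_i^{(j)}\in(J_j)_i$, $i\in[b_j,d_j]$, such that each structure map of $J_j$ between consecutive vertices of $[b_j,d_j]$ (in whichever direction it points) carries the chosen generator at its source to the chosen generator at its target. Breaker pair: an ordered pair $(J_1,J_2)$ of interval summands with $J_1\cong I[b_1,d_1]$, $J_2\cong I[b_2,d_2]$ is a breaker pair if $b_1<b_2\le d_1<d_2$, the arrow between $b_2-1$ and $b_2$ is backward, $V_{b_2-1}\leftarrow V_{b_2}$, and the arrow between $d_1$ and $d_1+1$ is forward, $V_{d_1}\to V_{d_1+1}$. Breaker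 chain: a sequence of interval summands $J_1,\dots,J_r$ with $r\ge 2$ such that $(J_j,J_{j+1})$ is a breaker pair for every $1\le j<r$. Writing $J_j\cong I[b_j,d_j]$, the chain spans $[p,q]$ if $b_1=p$ and $d_r=q$. *)

theory Defs
  imports Complex_Main "HOL-Library.FuncSet"
begin

text \<open>
  The spaces of a zigzag module are subspaces of one ambient vector space of type \<open>'v\<close>; this is no
  loss of generality, the ambient space can be taken to be the direct sum of all of them.
  \<open>fwd M i\<close> says that the arrow between vertices \<open>i\<close> and \<open>i + 1\<close> points forward, and \<open>arr M i\<close> is
  the map on that arrow, whichever direction it has.  Only the vertices in \<open>{lo M..hi M}\<close>, the
  arrows between them, and the values of each \<open>arr M i\<close> on its source space are meaningful.
\<close>

record ('k, 'v) zigzag =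
  lo :: nat
  hi :: nat
  fwd :: "nat \<Rightarrow> bool"
  scl :: "'k \<Rightarrow> 'v \<Rightarrow> 'v"
  vspace :: "nat \<Rightarrow> 'v set"
  arr :: "nat \<Rightarrow> 'v \<Rightarrow> 'v"

definition src :: "('k, 'v) zigzag \<Rightarrow> nat \<Rightarrow> nat"
  where "src M i = (if fwd M i then i else Suc i)"

definition tgt :: "('k, 'v) zigzag \<Rightarrow> nat \<Rightarrow> nat"
  where "tgt M i = (if fwd M i then Suc i else i)"

definition linear_between ::
  "('k \<Rightarrow> 'v::ab_group_add \<Rightarrow> 'v) \<Rightarrow> ('k \<Rightarrow> 'w::ab_group_add \<Rightarrow> 'w) \<Rightarrow> 'v set \<Rightarrow> 'w set \<Rightarrow> ('v \<Rightarrow> 'w) \<Rightarrow> bool"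
  where "linear_between s t A B f \<longleftrightarrow>
    f \<in> A \<rightarrow> B \<and>
    (\<forall>x\<in>A. \<forall>y\<in>A. f (x + y) = f x + f y) \<and>
    (\<forall>c. \<forall>x\<in>A. f (s c x) = t c (f x))"

definition zigzag_module :: "('k::field, 'v::ab_group_add) zigzag \<Rightarrow> bool"
  where "zigzag_module M \<longleftrightarrow>
    vector_space (scl M) \<and>
    (\<forall>i\<in>{lo M..hi M}. module.subspace (scl M) (vspace M i) \<and>
      (\<exists>B. finite B \<and> B \<subseteq> vspace M i \<and> module.span (scl M) B = vspace M i)) \<and>
    (\<forall>i\<in>{lo M..<hi M}.
      linear_between (scl M) (scl M) (vspace M (src M i)) (vspace M (tgt M i)) (arr M i))"

definition restriction :: "('k, 'v) zigzag \<Rightarrow> nat \<Rightarrow> nat \<Rightarrow> ('k, 'v) zigzag"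
  where "restriction M p q = M\<lparr>lo := p, hi := q\<rparr>"

definition zigzag_hom ::
  "('k, 'v::ab_group_add) zigzag \<Rightarrow> ('k, 'w::ab_group_add) zigzag \<Rightarrow> (nat \<Rightarrow> 'v \<Rightarrow> 'w) \<Rightarrow> bool"
  where "zigzag_hom M N \<phi> \<longleftrightarrow>
    lo M = lo N \<and> hi M = hi N \<and> (\<forall>i\<in>{lo M..<hi M}. fwd M i = fwd N i) \<and>
    (\<forall>i\<in>{lo M..hi M}. linear_between (scl M) (scl N) (vspace M i) (vspace N i) (\<phi> i)) \<and>
    (\<forall>i\<in>{lo M..<hi M}. \<forall>x\<in>vspace M (src M i). \<phi> (tgt M i) (arr M i x) = arr N i (\<phi> (src M i) x))"

definition zigzag_isomorphic ::
  "('k, 'v::ab_group_add) zigzag \<Rightarrow> ('k, 'w::ab_group_add) zigzag \<Rightarrow> bool"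
  where "zigzag_isomorphic M N \<longleftrightarrow>
    (\<exists>\<phi>. zigzag_hom M N \<phi> \<and> (\<forall>i\<in>{lo M..hi M}. bij_betw (\<phi> i) (vspace M i) (vspace N i)))"

definition is_submodule :: "('k::field, 'v::ab_group_add) zigzag \<Rightarrow> (nat \<Rightarrow> 'v set) \<Rightarrow> bool"
  where "is_submodule M W \<longleftrightarrow>
    (\<forall>i\<in>{lo M..hi M}. module.subspace (scl M) (W i) \<and> W i \<subseteq> vspace M i) \<and>
    (\<forall>i\<in>{lo M..<hi M}. arr M i ` W (src M i) \<subseteq> W (tgt M i))"

definition sub_zigzag :: "('k, 'v) zigzag \<Rightarrow> (nat \<Rightarrow> 'v set) \<Rightarrow> ('k, 'v) zigzag"
  where "sub_zigzag M W = M\<lparr>vspace := W\<rparr>"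

definition inclusion_splits :: "('k, 'v::ab_group_add) zigzag \<Rightarrow> (nat \<Rightarrow> 'v set) \<Rightarrow> bool"
  where "inclusion_splits M W \<longleftrightarrow>
    (\<exists>\<rho>. zigzag_hom M (sub_zigzag M W) \<rho> \<and> (\<forall>i\<in>{lo M..hi M}. \<forall>x\<in>W i. \<rho> i x = x))"

definition interval_module ::
  "nat \<Rightarrow> nat \<Rightarrow> (nat \<Rightarrow> bool) \<Rightarrow> nat \<Rightarrow> nat \<Rightarrow> ('k::field, 'k) zigzag"
  where "interval_module p q f b d =
    \<lparr>lo = p, hi = q, fwd = f, scl = (*),
     vspace = (\<lambda>i. if i \<in> {b..d} then UNIV else {0}),
     arr = (\<lambda>i x. if i \<in> {b..d} \<and> Suc i \<in> {b..d} then x else 0)\<rparr>"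

definition iso_interval ::
  "('k::field, 'v::ab_group_add) zigzag \<Rightarrow> (nat \<Rightarrow> 'v set) \<Rightarrow> nat \<Rightarrow> nat \<Rightarrow> bool"
  where "iso_interval M W b d \<longleftrightarrow>
    lo M \<le> b \<and> b \<le> d \<and> d \<le> hi M \<and>
    zigzag_isomorphic (sub_zigzag M W) (interval_module (lo M) (hi M) (fwd M) b d)"

definition direct_family ::
  "('k, 'v::ab_group_add) zigzag \<Rightarrow> 'a set \<Rightarrow> ('a \<Rightarrow> nat \<Rightarrow> 'v set) \<Rightarrow> bool"
  where "direct_family M A F \<longleftrightarrow>
    (\<forall>i\<in>{lo M..hi M}. inj_on (\<lambda>c. \<Sum>a\<in>A. c a) (\<Pi>\<^sub>E a\<in>A. F a i))"

text \<open>The internal sum of a family of submodules; it is a direct sum if \<open>direct_family\<close> holds.\<close>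

definition internal_sum :: "'a set \<Rightarrow> ('a \<Rightarrow> nat \<Rightarrow> 'v::ab_group_add set) \<Rightarrow> nat \<Rightarrow> 'v set"
  where "internal_sum A F i = (\<lambda>c. \<Sum>a\<in>A. c a) ` (\<Pi>\<^sub>E a\<in>A. F a i)"

text \<open>
  A set of submodules, rather than an indexed family, suffices here: the summands are nonzero and
  independent, so distinct summands are distinct as submodules.
\<close>

definition interval_decomposition ::
  "('k::field, 'v::ab_group_add) zigzag \<Rightarrow> (nat \<Rightarrow> 'v set) set \<Rightarrow> bool"
  where "interval_decomposition M D \<longleftrightarrow>
    finite D \<and>
    (\<forall>W\<in>D. is_submodule M W \<and> (\<exists>b d. iso_interval M W b d)) \<and>
    direct_family M D (\<lambda>W. W) \<and>
    (\<forall>i\<in>{lo M..hi M}. internal_sum D (\<lambda>W. W) i = vspace M i)"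

definition breaker_pair ::
  "('k::field, 'v::ab_group_add) zigzag \<Rightarrow> (nat \<Rightarrow> 'v set) \<Rightarrow> nat \<Rightarrow> nat \<Rightarrow>
    (nat \<Rightarrow> 'v set) \<Rightarrow> nat \<Rightarrow> nat \<Rightarrow> bool"
  where "breaker_pair M J\<^sub>1 b\<^sub>1 d\<^sub>1 J\<^sub>2 b\<^sub>2 d\<^sub>2 \<longleftrightarrow>
    iso_interval M J\<^sub>1 b\<^sub>1 d\<^sub>1 \<and> iso_interval M J\<^sub>2 b\<^sub>2 d\<^sub>2 \<and>
    b\<^sub>1 < b\<^sub>2 \<and> b\<^sub>2 \<le> d\<^sub>1 \<and> d\<^sub>1 < d\<^sub>2 \<and>
    \<not> fwd M (b\<^sub>2 - 1) \<and> fwd M d\<^sub>1"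

definition breaker_chain ::
  "('k::field, 'v::ab_group_add) zigzag \<Rightarrow> (nat \<Rightarrow> 'v set) set \<Rightarrow> nat \<Rightarrow>
    (nat \<Rightarrow> nat \<Rightarrow> 'v set) \<Rightarrow> (nat \<Rightarrow> nat) \<Rightarrow> (nat \<Rightarrow> nat) \<Rightarrow> bool"
  where "breaker_chain M D r J b d \<longleftrightarrow>
    r \<ge> 2 \<and> (\<forall>j\<in>{1..r}. J j \<in> D) \<and>
    (\<forall>j\<in>{1..<r}. breaker_pair M (J j) (b j) (d j) (J (Suc j)) (b (Suc j)) (d (Suc j)))"

definition compatible_generators ::
  "('k, 'v::ab_group_add) zigzag \<Rightarrow> (nat \<Rightarrow> 'v set) \<Rightarrow> nat \<Rightarrow> nat \<Rightarrow> (nat \<Rightarrow> 'v) \<Rightarrow> bool"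
  where "compatible_generators M W b d x \<longleftrightarrow>
    (\<forall>i\<in>{b..d}. x i \<in> W i \<and> x i \<noteq> 0) \<and>
    (\<forall>i\<in>{b..<d}. arr M i (x (src M i)) = x (tgt M i))"

lemma iso_interval_zero_iff:
  fixes M :: "('k::field, 'v::ab_group_add) zigzag"
  assumes W: "is_submodule M W" "vector_space (scl M)" and I: "iso_interval M W b d"
    and i: "i \<in> {lo M..hi M}"
  shows "W i = {0} \<longleftrightarrow> i \<notin> {b..d}"
proof -
  let ?N = "interval_module (lo M) (hi M) (fwd M) b d :: ('k, 'k) zigzag"
  interpret vector_space "scl M" by (rule W(2))
  have "zigzag_isomorphic (sub_zigzag M W) ?N" using I unfolding iso_interval_def by (elim conjE)
  then obtain \<phi> where
    "\<forall>j\<in>{lo (sub_zigzag M W)..hi (sub_zigzag M W)}.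
      bij_betw (\<phi> j) (vspace (sub_zigzag M W) j) (vspace ?N j)"
    unfolding zigzag_isomorphic_def by (elim exE conjE)
  then have bij: "bij_betw (\<phi> i) (W i) (vspace ?N i)"
    using i by (simp add: sub_zigzag_def)
  have sub: "subspace (W i)" using W(1) i by (auto simp: is_submodule_def)
  show ?thesis
  proof
    assume "W i = {0}"
    then have N: "vspace ?N i = {\<phi> i 0}" using bij unfolding bij_betw_def by auto
    have "(UNIV :: 'k set) \<noteq> {\<phi> i 0}"
      using UNIV_I[of "0::'k"] UNIV_I[of "1::'k"] by (metis singletonD zero_neq_one)
    then have "vspace ?N i \<noteq> UNIV" unfolding N by (rule not_sym)
    then show "i \<notin> {b..d}" unfolding interval_module_def zigzag.simps by (rule contrapos_nn) (rule if_P)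
  next
    assume "i \<notin> {b..d}"
    then have "vspace ?N i = {0}" by (auto simp: interval_module_def)
    then have *: "inj_on (\<phi> i) (W i)" "\<phi> i ` W i = {0}" using bij by (simp_all add: bij_betw_def)
    have "0 \<in> W i" using sub by (rule subspace_0)
    have img: "\<phi> i y = 0" if "y \<in> W i" for y
      using imageI[OF that, of "\<phi> i"] unfolding *(2) by (rule singletonD)
    have "x = 0" if x: "x \<in> W i" for x
      by (rule inj_onD[OF *(1) _ x \<open>0 \<in> W i\<close>]) (simp only: img[OF x] img[OF \<open>0 \<in> W i\<close>])
    with \<open>0 \<in> W i\<close> show "W i = {0}" by (intro equalityI subsetI) simp_all
  qed
qed

text \<open>The members of a breaker chain are independent, so their internal sum is a direct sum.\<close>

lemma direct_family_breaker_chain: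
  fixes M :: "('k::field, 'v::ab_group_add) zigzag"
  assumes vs: "vector_space (scl M)"
    and dec: "interval_decomposition M D" and ch: "breaker_chain M D r J b d"
  shows "direct_family M {1..r} J"
proof -
  interpret vector_space "scl M" by (rule vs)
  have fin: "finite D" and subD: "\<And>W. W \<in> D \<Longrightarrow> is_submodule M W"
    and dirD: "direct_family M D (\<lambda>W. W)"
    using dec by (auto simp: interval_decomposition_def)
  have r: "r \<ge> 2" and JD: "\<And>j. j \<in> {1..r} \<Longrightarrow> J j \<in> D"
    and bp: "\<And>j. j \<in> {1..<r} \<Longrightarrow> breaker_pair M (J j) (b j) (d j) (J (Suc j)) (b (Suc j)) (d (Suc j))"
    using ch by (auto simp: breaker_chain_def)
  have iso: "iso_interval M (J j) (b j) (d j)" if j: "j \<in> {1..r}" for j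
  proof (cases "j < r")
    case True then show ?thesis using bp[of j] j by (auto simp: breaker_pair_def)
  next
    case False
    then have "j - 1 \<in> {1..<r}" "Suc (j - 1) = j" using j r by auto
    then show ?thesis using bp[of "j - 1"] by (auto simp: breaker_pair_def)
  qed
  have mono: "b i < b j" if "i < j" "1 \<le> i" "j \<le> r" for i j
    using that
  proof (induction j rule: less_induct)
    case (less j)
    then obtain k where k: "j = Suc k" by (cases j) auto
    have "b k < b j" using bp[of k] less.prems k by (auto simp: breaker_pair_def)
    moreover have "i = k \<or> b i < b k"
    proof (cases "i = k")
      case False
      then have "i < k" "k < j" "k \<le> r" using less.prems k by simp_all
      then show ?thesis using less.IH[of k] less.prems(2) by blast
    qed blast
    ultimately show ?case by (metis order.strict_trans)
  qed
  have neq: "J i \<noteq> J j" if ij: "i < j" "1 \<le> i" "j \<le> r" for i j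
  proof
    assume eq: "J i = J j"
    have I: "iso_interval M (J i) (b i) (d i)" "iso_interval M (J j) (b j) (d j)"
      using iso ij by auto
    have m: "b i \<in> {lo M..hi M}" "b i \<in> {b i..d i}" using I(1) by (auto simp: iso_interval_def)
    have S: "is_submodule M (J i)" "is_submodule M (J j)" using subD JD ij by auto
    have "J i (b i) \<noteq> {0}" using iso_interval_zero_iff[OF S(1) vs I(1) m(1)] m by simp
    moreover have "J j (b i) = {0}"
      using iso_interval_zero_iff[OF S(2) vs I(2) m(1)] mono[OF ij] by simp
    ultimately show False using eq by simp
  qed
  have injJ: "inj_on J {1..r}"
    by (rule linorder_inj_onI) (use neq in auto)
  show ?thesis unfolding direct_family_def
  proof (intro ballI inj_onI)
    fix i c c'
    assume i: "i \<in> {lo M..hi M}"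
      and c: "c \<in> (\<Pi>\<^sub>E j\<in>{1..r}. J j i)" and c': "c' \<in> (\<Pi>\<^sub>E j\<in>{1..r}. J j i)"
      and eq: "(\<Sum>j\<in>{1..r}. c j) = (\<Sum>j\<in>{1..r}. c' j)"
    define g where "g = the_inv_into {1..r} J"
    have gJ: "g (J j) = j" if "j \<in> {1..r}" for j
      unfolding g_def using the_inv_into_f_f[OF injJ that] .
    define e where "e = (\<lambda>c W. if W \<in> D then (if W \<in> J ` {1..r} then c (g W) else 0) else (undefined :: 'v))"
    have e_in: "e c \<in> (\<Pi>\<^sub>E W\<in>D. W i)" if "c \<in> (\<Pi>\<^sub>E j\<in>{1..r}. J j i)" for c
    proof (rule PiE_I)
      fix W assume W: "W \<in> D"
      then have "0 \<in> W i" using subD i subspace_0 by (auto simp: is_submodule_def)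
      then show "e c W \<in> W i"
      proof (cases "W \<in> J ` {1..r}")
        case True
        then obtain j where j: "j \<in> {1..r}" "W = J j" by blast
        then show ?thesis using W gJ[OF j(1)] PiE_mem[OF that j(1)] by (simp add: e_def)
      qed (simp add: e_def W)
    qed (simp add: e_def)
    have e_sum: "(\<Sum>W\<in>D. e c W) = (\<Sum>j\<in>{1..r}. c j)" for c
    proof -
      have "(\<Sum>W\<in>D. e c W) = (\<Sum>W\<in>J ` {1..r}. e c W)"
        using fin JD by (intro sum.mono_neutral_right) (auto simp: e_def)
      also have "\<dots> = (\<Sum>j\<in>{1..r}. e c (J j))" using injJ by (simp add: sum.reindex)
      also have "\<dots> = (\<Sum>j\<in>{1..r}. c j)" using gJ JD by (intro sum.cong) (auto simp: e_def)
      finally show ?thesis .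
    qed
    have "e c = e c'"
    proof (rule inj_onD[OF _ _ e_in[OF c] e_in[OF c']])
      show "inj_on (\<lambda>c. \<Sum>W\<in>D. c W) (\<Pi>\<^sub>E W\<in>D. W i)"
        using dirD i unfolding direct_family_def by blast
      show "(\<Sum>W\<in>D. e c W) = (\<Sum>W\<in>D. e c' W)"
        unfolding e_sum by (rule eq)
    qed
    then have ec: "e c (J j) = e c' (J j)" for j by simp
    have "c j = c' j" if "j \<in> {1..r}" for j
    proof -
      have "e c (J j) = c j" "e c' (J j) = c' j"
        unfolding e_def using that gJ[OF that] JD[OF that] by simp_all
      with ec[of j] show ?thesis by simp
    qed
    then show "c = c'" by (rule PiE_ext[OF c c'])
  qed
qed

end

theory Submission
  imports Defs
begin

text \<open>
  Extend the generators of \<open>J\<^sub>j\<close> by zero to all of \<open>[p, q]\<close>.  The arrow conditions at the ends of a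
  breaker pair say precisely that no arrow points into the support of \<open>J\<^sub>j\<close> from outside, so the
  extension is still compatible with all arrows, and hence so is the sum \<open>z\<close> of these extensions,
  which vanishes nowhere because the intervals cover \<open>[p, q]\<close>.  A retraction onto \<open>S\<close> maps the
  extended generators of \<open>J\<^sub>j\<close> to a compatible family \<open>c\<^sub>i z\<^sub>i\<close>, whose coefficients \<open>c\<^sub>i\<close> are therefore
  constant in \<open>i\<close>; they vanish since no \<open>J\<^sub>j\<close> has full support.  So the retraction maps \<open>z\<close> to \<open>0\<close>.
\<close>

text \<open>For a submodule \<open>W\<close> this is a homomorphism from the interval module with
  full support to \<open>W\<close>, recorded by the images of the generators 1. Unlike in
  \<open>compatible_generators\<close>, the vectors may vanish.\<close>

definition compatible_section ::
  "('k, 'v) zigzag \<Rightarrow> (nat \<Rightarrow> 'v set) \<Rightarrow> (nat \<Rightarrow> 'v) \<Rightarrow> bool"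
  where "compatible_section M W y \<longleftrightarrow>
    (\<forall>i\<in>{lo M..hi M}. y i \<in> W i) \<and> (\<forall>i\<in>{lo M..<hi M}. arr M i (y (src M i)) = y (tgt M i))"

section \<open>Endpoints of arrows and linear maps on subspaces\<close>

lemma src_tgt_in:
  assumes "i \<in> {lo M..<hi M}"
  shows "src M i \<in> {lo M..hi M}" "tgt M i \<in> {lo M..hi M}"
  using assms by (auto simp: src_def tgt_def)

lemma linear_between_0:
  assumes "linear_between s t A B f" "0 \<in> A"
  shows "f 0 = 0"
proof -
  have "f (0 + 0) = f 0 + f 0" using assms unfolding linear_between_def by blast
  then show ?thesis by simp
qed

text \<open>Additivity is known on \<open>A\<close> alone, so the induction relies on partial sums
  staying in the subspace \<open>A\<close>. For infinite \<open>I\<close> both sums are 0 by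
  convention, which leaves \<open>f 0 = 0\<close>.\<close>

lemma linear_between_sum:
  assumes f: "linear_between s t A B f" and A: "vector_space s" "module.subspace s A"
    and g: "\<And>a. a \<in> I \<Longrightarrow> g a \<in> A"
  shows "f (\<Sum>a\<in>I. g a) = (\<Sum>a\<in>I. f (g a))"
proof -
  interpret vector_space s by (rule A(1))
  show ?thesis using g
  proof (induction I rule: infinite_finite_induct)
    case (insert a I)
    then have "g a \<in> A" "(\<Sum>a\<in>I. g a) \<in> A" by (auto intro!: subspace_sum[OF A(2)])
    then have "f (g a + (\<Sum>a\<in>I. g a)) = f (g a) + f (\<Sum>a\<in>I. g a)"
      using f unfolding linear_between_def by blast
    then show ?case using insert by simp
  qed (use linear_between_0[OF f subspace_0[OF A(2)]] in simp_all)
qed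

lemma zigzag_module_restriction:
  assumes "zigzag_module M" "lo M \<le> p" "q \<le> hi M"
  shows "zigzag_module (restriction M p q)"
  using assms by (auto simp: zigzag_module_def restriction_def src_def tgt_def)

section \<open>Internal and direct sums of families of subspaces\<close>

lemma internal_sumI:
  assumes "\<And>a. a \<in> A \<Longrightarrow> c a \<in> F a i"
  shows "(\<Sum>a\<in>A. c a) \<in> internal_sum A F i"
  unfolding internal_sum_def
  \<comment> \<open>\<open>internal_sum\<close> ranges over extensional families, hence the
    restriction.\<close>
  by (rule image_eqI[where x = "restrict c A"]) (use assms in auto)

lemma internal_sumE:
  assumes "v \<in> internal_sum A F i"
  obtains c where "\<And>a. a \<in> A \<Longrightarrow> c a \<in> F a i" "v = (\<Sum>a\<in>A. c a)"
  using assms unfolding internal_sum_def by (auto simp: PiE_iff)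

lemma subspace_internal_sum:
  assumes "vector_space s" and F: "\<And>a. a \<in> A \<Longrightarrow> module.subspace s (F a i)"
  shows "module.subspace s (internal_sum A F i)"
proof -
  interpret vector_space s by (rule assms(1))
  show ?thesis
  proof (rule subspaceI)
    show "0 \<in> internal_sum A F i"
      using internal_sumI[of A "\<lambda>_. 0" F i] F subspace_0 by simp
  next
    fix u v assume "u \<in> internal_sum A F i" "v \<in> internal_sum A F i"
    then obtain c e where "\<And>a. a \<in> A \<Longrightarrow> c a \<in> F a i" "\<And>a. a \<in> A \<Longrightarrow> e a \<in> F a i"
      and eq: "u = (\<Sum>a\<in>A. c a)" "v = (\<Sum>a\<in>A. e a)" by (metis internal_sumE)
    then have "(\<Sum>a\<in>A. c a + e a) \<in> internal_sum A F i"
      by (intro internal_sumI) (simp add: F subspace_add)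
    then show "u + v \<in> internal_sum A F i" by (simp add: eq sum.distrib)
  next
    fix k u assume "u \<in> internal_sum A F i"
    then obtain c where "\<And>a. a \<in> A \<Longrightarrow> c a \<in> F a i" and eq: "u = (\<Sum>a\<in>A. c a)"
      by (metis internal_sumE)
    then have "(\<Sum>a\<in>A. s k (c a)) \<in> internal_sum A F i"
      by (intro internal_sumI) (simp add: F subspace_scale)
    then show "s k u \<in> internal_sum A F i" by (simp add: eq scale_sum_right)
  qed
qed

text \<open>Injectivity of the sum map, applied to \<open>c\<close> and the zero family, both
  restricted to \<open>A\<close> to make them extensional.\<close>

lemma direct_family_sum_eq_0:
  assumes dir: "direct_family M A F" and i: "i \<in> {lo M..hi M}"
    and zero: "\<And>a. a \<in> A \<Longrightarrow> 0 \<in> F a i" and c: "\<And>a. a \<in> A \<Longrightarrow> c a \<in> F a i"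
    and sum: "(\<Sum>a\<in>A. c a) = 0" and a: "a \<in> A"
  shows "c a = 0"
proof -
  have "restrict c A = (\<lambda>a\<in>A. 0)"
  proof (rule inj_onD)
    show "inj_on (\<lambda>c. \<Sum>a\<in>A. c a) (\<Pi>\<^sub>E a\<in>A. F a i)"
      using dir i by (simp add: direct_family_def)
  qed (use zero c sum in auto)
  then show ?thesis using a by (metis restrict_apply')
qed

section \<open>Construction of compatible sections\<close>

text \<open>An arrow inside the support is handled by the generators, one leaving it maps into a
  zero space, and one starting outside it also ends outside, where 0 goes to 0. If
  \<open>b = 0\<close>, then \<open>b = lo M\<close>, so the truncated \<open>b - 1\<close> does no
  harm.\<close>

lemma compatible_section_extend_by_zero:
  assumes M: "zigzag_module M" and W: "is_submodule M W" "iso_interval M W b d"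
    and x: "compatible_generators M W b d x"
    and left: "b = lo M \<or> \<not> fwd M (b - 1)" and right: "d = hi M \<or> fwd M d"
  shows "compatible_section M W (\<lambda>i. if i \<in> {b..d} then x i else 0)"
    (is "compatible_section M W ?y")
proof -
  have vs: "vector_space (scl M)" using M by (simp add: zigzag_module_def)
  interpret vector_space "scl M" by (rule vs)
  have bd: "lo M \<le> b" "b \<le> d" "d \<le> hi M" using W(2) by (auto simp: iso_interval_def)
  have sub: "subspace (W i)" "W i \<subseteq> vspace M i" if "i \<in> {lo M..hi M}" for i
    using W(1) that by (auto simp: is_submodule_def)
  have y: "?y i \<in> W i" if "i \<in> {lo M..hi M}" for i
    using x sub(1)[OF that] subspace_0 by (auto simp: compatible_generators_def)
  have "arr M i (?y (src M i)) = ?y (tgt M i)" if i: "i \<in> {lo M..<hi M}" for i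
  proof (cases "src M i \<in> {b..d}")
    case s: True
    show ?thesis
    proof (cases "tgt M i \<in> {b..d}")
      case True
      then have "i \<in> {b..<d}" using s by (auto simp: src_def tgt_def split: if_splits)
      then show ?thesis using s True x by (simp add: compatible_generators_def)
    next
      case False
      \<comment> \<open>The arrow leaves the support, so its target space in \<open>W\<close> is
        zero.\<close>
      have "arr M i (?y (src M i)) \<in> W (tgt M i)"
        using W(1) i y[OF src_tgt_in(1)[OF i]] unfolding is_submodule_def by blast
      also have "W (tgt M i) = {0}"
        using iso_interval_zero_iff[OF W(1) vs W(2) src_tgt_in(2)[OF i]] False by simp
      finally show ?thesis by (simp only: singleton_iff False if_False)
    qed
  next
    case s: False
    \<comment> \<open>An arrow entering the support would cross its left end forward or its right
      end backward; \<open>left\<close> and \<open>right\<close> exclude these.\<close>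
    have "tgt M i \<notin> {b..d}"
    proof
      assume t: "tgt M i \<in> {b..d}"
      show False
      proof (cases "fwd M i")
        case True
        then have "b = Suc i" using s t by (auto simp: src_def tgt_def)
        then show False using left True i by auto
      next
        case False
        then have "d = i" using s t by (auto simp: src_def tgt_def)
        then show False using right False i by auto
      qed
    qed
    moreover have "arr M i 0 = 0"
      using M i sub[OF src_tgt_in(1)[OF i]] subspace_0
      by (intro linear_between_0[of "scl M" "scl M" "vspace M (src M i)" "vspace M (tgt M i)"])
        (auto simp: zigzag_module_def)
    ultimately show ?thesis using s by (simp only: if_False)
  qed
  with y show ?thesis unfolding compatible_section_def by blast
qed

lemma compatible_section_sum:
  assumes M: "zigzag_module M" and F: "\<And>a. a \<in> A \<Longrightarrow> is_submodule M (F a)"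
    and y: "\<And>a. a \<in> A \<Longrightarrow> compatible_section M (F a) (y a)"
  shows "compatible_section M (internal_sum A F) (\<lambda>i. \<Sum>a\<in>A. y a i)"
  unfolding compatible_section_def
proof (intro conjI ballI)
  fix i assume "i \<in> {lo M..hi M}"
  then show "(\<Sum>a\<in>A. y a i) \<in> internal_sum A F i"
    using y by (intro internal_sumI) (simp add: compatible_section_def)
next
  fix i assume i: "i \<in> {lo M..<hi M}"
  have "arr M i (\<Sum>a\<in>A. y a (src M i)) = (\<Sum>a\<in>A. arr M i (y a (src M i)))"
  proof (rule linear_between_sum)
    show "linear_between (scl M) (scl M) (vspace M (src M i)) (vspace M (tgt M i)) (arr M i)"
      "vector_space (scl M)" "module.subspace (scl M) (vspace M (src M i))"
      using M i src_tgt_in(1)[OF i] by (auto simp: zigzag_module_def)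
    show "y a (src M i) \<in> vspace M (src M i)" if "a \<in> A" for a
      using F[OF that] y[OF that] src_tgt_in(1)[OF i]
      unfolding is_submodule_def compatible_section_def by blast
  qed
  also have "\<dots> = (\<Sum>a\<in>A. y a (tgt M i))"
    using y i by (intro sum.cong) (auto simp: compatible_section_def)
  finally show "arr M i (\<Sum>a\<in>A. y a (src M i)) = (\<Sum>a\<in>A. y a (tgt M i))" .
qed

lemma arr_scale:
  assumes M: "zigzag_module M" and i: "i \<in> {lo M..<hi M}" and v: "v \<in> vspace M (src M i)"
  shows "arr M i (scl M k v) = scl M k (arr M i v)"
  using assms unfolding zigzag_module_def linear_between_def by blast

section \<open>The lines spanned by a compatible section\<close>

text \<open>By linearity each arrow sends a multiple of \<open>z\<close> at its source to the same
  multiple of \<open>z\<close> at its target.\<close>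

lemma is_submodule_span_section:
  assumes M: "zigzag_module M"
    and W: "\<And>i. i \<in> {lo M..hi M} \<Longrightarrow> module.subspace (scl M) (W i)"
      "\<And>i. i \<in> {lo M..hi M} \<Longrightarrow> W i \<subseteq> vspace M i"
    and z: "compatible_section M W z"
    and S: "\<And>i. i \<in> {lo M..hi M} \<Longrightarrow> S i = module.span (scl M) {z i}"
  shows "is_submodule (sub_zigzag M W) S"
proof -
  interpret vector_space "scl M" using M by (simp add: zigzag_module_def)
  have zW: "z i \<in> W i" if "i \<in> {lo M..hi M}" for i
    using z that by (simp add: compatible_section_def)
  have "subspace (S i)" "S i \<subseteq> W i" if "i \<in> {lo M..hi M}" for i
    using S[OF that] zW[OF that] W(1)[OF that] by (simp_all add: span_minimal)
  moreover have "arr M i ` S (src M i) \<subseteq> S (tgt M i)" if i: "i \<in> {lo M..<hi M}" for i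
  proof -
    note s = src_tgt_in(1)[OF i] and t = src_tgt_in(2)[OF i]
    have "arr M i (scl M k (z (src M i))) = scl M k (z (tgt M i))" for k
      using arr_scale[OF M i] z zW[OF s] W(2)[OF s] i by (auto simp: compatible_section_def)
    then show ?thesis using S[OF s] S[OF t] by (auto simp: span_singleton)
  qed
  ultimately show ?thesis by (simp add: is_submodule_def sub_zigzag_def src_def tgt_def)
qed

text \<open>The isomorphism takes the coordinate with respect to \<open>z i\<close>. Arrows preserve
  this coordinate, which is what the identity maps of the interval module require.\<close>

lemma span_section_isomorphic:
  assumes M: "zigzag_module M" and z: "compatible_section M (vspace M) z"
    and nz: "\<And>i. i \<in> {lo M..hi M} \<Longrightarrow> z i \<noteq> 0"
    and S: "\<And>i. i \<in> {lo M..hi M} \<Longrightarrow> S i = module.span (scl M) {z i}"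
  shows "zigzag_isomorphic (sub_zigzag M S) (interval_module (lo M) (hi M) (fwd M) (lo M) (hi M))"
proof -
  interpret vector_space "scl M" using M by (simp add: zigzag_module_def)
  \<comment> \<open>The description is unique on \<open>S i\<close> because \<open>z i\<close> is
    nonzero.\<close>
  define \<phi> where "\<phi> i v = (THE k. v = scl M k (z i))" for i v
  have \<phi>: "\<phi> i (scl M k (z i)) = k" if "i \<in> {lo M..hi M}" for i k
    unfolding \<phi>_def using nz[OF that] by (intro the_equality) auto
  have Sz: "S i = range (\<lambda>k. scl M k (z i))" if "i \<in> {lo M..hi M}" for i
    using S[OF that] by (simp add: span_singleton)
  have "linear_between (scl M) (*) (S i) UNIV (\<phi> i)" if i: "i \<in> {lo M..hi M}" for i
    unfolding linear_between_def Sz[OF i]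
    by (auto simp: \<phi>[OF i] scale_left_distrib[symmetric])
  moreover have "bij_betw (\<phi> i) (S i) UNIV" if i: "i \<in> {lo M..hi M}" for i
    unfolding bij_betw_def Sz[OF i] by (auto simp: inj_on_def image_image \<phi>[OF i])
  moreover have "\<phi> (tgt M i) (arr M i v) = \<phi> (src M i) v"
    if i: "i \<in> {lo M..<hi M}" and v: "v \<in> S (src M i)" for i v
  proof -
    note s = src_tgt_in(1)[OF i] and t = src_tgt_in(2)[OF i]
    obtain k where k: "v = scl M k (z (src M i))" using v Sz[OF s] by blast
    have "arr M i v = scl M k (z (tgt M i))"
      unfolding k using arr_scale[OF M i] z s i by (auto simp: compatible_section_def)
    then show ?thesis by (simp add: k \<phi>[OF s] \<phi>[OF t])
  qed
  ultimately show ?thesis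
    unfolding zigzag_isomorphic_def zigzag_hom_def
    by (intro exI[of _ \<phi>]) (simp add: sub_zigzag_def interval_module_def src_def tgt_def)
qed

section \<open>Homomorphisms into the span of a section\<close>

lemma nat_interval_constant:
  fixes f :: "nat \<Rightarrow> 'a"
  assumes step: "\<And>i. i \<in> {m..<n} \<Longrightarrow> f (Suc i) = f i" and "i \<in> {m..n}" "j \<in> {m..n}"
  shows "f i = f j"
proof -
  have "f (m + k) = f m" if "m + k \<le> n" for k
    using that
  proof (induction k)
    case (Suc k)
    then show ?case using step[of "m + k"] by simp
  qed simp
  then show ?thesis using assms(2,3) by (metis atLeastAtMost_iff le_add_diff_inverse)
qed

text \<open>Composing \<open>y\<close> with \<rho> gives a section of \<open>S\<close>. As
  \<open>S\<close> is a full interval module, such a section is a scalar multiple of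
  \<open>z\<close>, and one vertex where \<open>y\<close> vanishes forces the scalar to be
  0.\<close>

lemma hom_to_span_section_kills_vanishing:
  assumes M: "zigzag_module M" and z: "compatible_section M (vspace M) z"
    and nz: "\<And>i. i \<in> {lo M..hi M} \<Longrightarrow> z i \<noteq> 0"
    and S: "\<And>i. i \<in> {lo M..hi M} \<Longrightarrow> S i = module.span (scl M) {z i}"
    and \<rho>: "zigzag_hom (sub_zigzag M W) (sub_zigzag M S) \<rho>"
    and W: "\<And>i. i \<in> {lo M..hi M} \<Longrightarrow> 0 \<in> W i"
    and y: "compatible_section M W y"
    and m: "m \<in> {lo M..hi M}" "y m = 0"
    and i: "i \<in> {lo M..hi M}"
  shows "\<rho> i (y i) = 0"
proof -
  interpret vector_space "scl M" using M by (simp add: zigzag_module_def)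
  have lin: "linear_between (scl M) (scl M) (W i) (S i) (\<rho> i)" if "i \<in> {lo M..hi M}" for i
    using \<rho> that by (simp add: zigzag_hom_def sub_zigzag_def)
  have "\<exists>k. \<rho> i (y i) = scl M k (z i)" if "i \<in> {lo M..hi M}" for i
  proof -
    have "\<rho> i (y i) \<in> S i"
      using lin[OF that] y that by (auto simp: linear_between_def compatible_section_def)
    then show ?thesis using S[OF that] by (auto simp: span_singleton)
  qed
  then obtain c where c: "\<And>i. i \<in> {lo M..hi M} \<Longrightarrow> \<rho> i (y i) = scl M (c i) (z i)" by metis
  have step: "c (Suc i) = c i" if i: "i \<in> {lo M..<hi M}" for i
  proof -
    note s = src_tgt_in(1)[OF i] and t = src_tgt_in(2)[OF i]
    have ys: "y (src M i) \<in> W (src M i)" using y s by (simp add: compatible_section_def)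
    have "scl M (c (tgt M i)) (z (tgt M i)) = \<rho> (tgt M i) (arr M i (y (src M i)))"
      using c[OF t] y i by (simp add: compatible_section_def)
    also have "\<dots> = arr M i (\<rho> (src M i) (y (src M i)))"
      using \<rho> i ys by (simp add: zigzag_hom_def sub_zigzag_def src_def tgt_def)
    also have "\<dots> = scl M (c (src M i)) (z (tgt M i))"
      using c[OF s] arr_scale[OF M i] z s i by (simp add: compatible_section_def)
    \<comment> \<open>The nonzero vector at the target cancels. The resulting equation is symmetric
      in the two ends, so it serves both arrow directions.\<close>
    finally have "c (tgt M i) = c (src M i)" using nz[OF t] by simp
    then show ?thesis by (auto simp: src_def tgt_def split: if_splits)
  qed
  have "scl M (c m) (z m) = 0"
    using c[OF m(1)] m linear_between_0[OF lin[OF m(1)] W[OF m(1)]] by simp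
  then have "c m = 0" using nz[OF m(1)] by simp
  moreover have "c i = c m" using step i m(1) by (rule nat_interval_constant)
  ultimately show ?thesis using c[OF i] by simp
qed

section \<open>The breaker chain and the sum of its generators\<close>

text \<open>Induction on \<open>r\<close>: a point beyond \<open>d r\<close> is at least
  \<open>b (Suc r)\<close> by the overlap, so the new interval contains it; any other point is
  already covered.\<close>

lemma chain_intervals_cover:
  fixes b d :: "nat \<Rightarrow> nat"
  assumes overlap: "\<And>j. j \<in> {1..<r} \<Longrightarrow> b (Suc j) \<le> d j" and "r \<ge> 1"
    and i: "b 1 \<le> i" "i \<le> d r"
  obtains j where "j \<in> {1..r}" "i \<in> {b j..d j}"
proof -
  have "\<exists>j\<in>{1..r}. i \<in> {b j..d j}"
    using \<open>r \<ge> 1\<close> overlap i(2)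
  proof (induction r rule: dec_induct)
    case base
    then show ?case using i(1) by auto
  next
    case (step r)
    show ?case
    proof (cases "i \<le> d r")
      case True
      then have "\<exists>j\<in>{1..r}. i \<in> {b j..d j}" using step by simp
      then show ?thesis by fastforce
    next
      case False
      then have "i \<in> {b (Suc r)..d (Suc r)}" using step.prems(1)[of r] step.prems(2) step.hyps(1) by auto
      then show ?thesis by (intro bexI[of _ "Suc r"]) simp_all
    qed
  qed
  then show ?thesis using that by blast
qed

theorem proposition3p20:
  fixes V :: "('k::field, 'v::ab_group_add) zigzag"
    and n p q r :: nat
    and D :: "(nat \<Rightarrow> 'v set) set"
    and J :: "nat \<Rightarrow> nat \<Rightarrow> 'v set"
    and b d :: "nat \<Rightarrow> nat"
    and x :: "nat \<Rightarrow> nat \<Rightarrow> 'v"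
    and z :: "nat \<Rightarrow> 'v"
    and S :: "nat \<Rightarrow> 'v set"
  assumes "zigzag_module V" and "lo V = 1" and "hi V = n"
    and "1 \<le> p" and "p \<le> q" and "q \<le> n"
    and "interval_decomposition (restriction V p q) D"
    and "breaker_chain (restriction V p q) D r J b d"
    and "b 1 = p" and "d r = q"
    and "\<And>j. j \<in> {1..r} \<Longrightarrow> compatible_generators (restriction V p q) (J j) (b j) (d j) (x j)"
    and "\<And>i. i \<in> {p..q} \<Longrightarrow> z i = (\<Sum>j | j \<in> {1..r} \<and> i \<in> {b j..d j}. x j i)"
    and "\<And>i. i \<in> {p..q} \<Longrightarrow> S i = module.span (scl V) {z i}"
  shows "is_submodule (sub_zigzag (restriction V p q) (internal_sum {1..r} J)) S
    \<and> zigzag_isomorphic (sub_zigzag (restriction V p q) S) (interval_module p q (fwd V) p q)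
    \<and> \<not> inclusion_splits (sub_zigzag (restriction V p q) (internal_sum {1..r} J)) S"
proof -
  define M where "M = restriction V p q"
  have M_simps: "lo M = p" "hi M = q" "fwd M = fwd V" "scl M = scl V"
    by (simp_all add: M_def restriction_def)
  have M: "zigzag_module M"
    unfolding M_def using assms(1-6) by (intro zigzag_module_restriction) auto
  have vs: "vector_space (scl M)" using M by (simp add: zigzag_module_def)
  interpret vector_space "scl M" by (rule vs)
  have dec: "interval_decomposition M D" and ch: "breaker_chain M D r J b d"
    using assms(7,8) by (simp_all add: M_def)
  have r: "r \<ge> 2" and JD: "\<And>j. j \<in> {1..r} \<Longrightarrow> J j \<in> D"
    and bp: "\<And>j. j \<in> {1..<r} \<Longrightarrow> breaker_pair M (J j) (b j) (d j) (J (Suc j)) (b (Suc j)) (d (Suc j))"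
    using ch by (auto simp: breaker_chain_def)
  have subm: "is_submodule M (J j)" if "j \<in> {1..r}" for j
    using dec JD[OF that] by (auto simp: interval_decomposition_def)
  have subJ: "subspace (J j i)" if "j \<in> {1..r}" "i \<in> {lo M..hi M}" for i j
    using subm[OF that(1)] that(2) by (simp add: is_submodule_def)
  \<comment> \<open>Except at the two ends of the chain, \<open>J j\<close> is the second member of
    one breaker pair and the first member of the next; the former controls its left end, the latter
    its right end.\<close>
  have first: "j = 1 \<or> j - 1 \<in> {1..<r} \<and> Suc (j - 1) = j"
    and last: "j = r \<or> j \<in> {1..<r}" if "j \<in> {1..r}" for j using that by auto
  have iso: "iso_interval M (J j) (b j) (d j)" if "j \<in> {1..r}" for j
  proof (cases "j = r")
    case True
    then show ?thesis using first[OF that] bp[of "j - 1"] r by (auto simp: breaker_pair_def)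
  next
    case False
    then show ?thesis using last[OF that] bp[of j] by (auto simp: breaker_pair_def)
  qed
  define y where "y j i = (if i \<in> {b j..d j} then x j i else 0)" for j i
  have y: "compatible_section M (J j) (y j)" if j: "j \<in> {1..r}" for j
    unfolding y_def
  proof (rule compatible_section_extend_by_zero[OF M subm[OF j] iso[OF j]])
    show "compatible_generators M (J j) (b j) (d j) (x j)" using assms(11)[OF j] by (simp add: M_def)
    \<comment> \<open>For \<open>j = 1\<close> the left end is \<open>p\<close>; otherwise the pair
      with the predecessor makes the arrow there backward. The right end is dual.\<close>
    show "b j = lo M \<or> \<not> fwd M (b j - 1)"
      using first[OF j] bp[of "j - 1"] assms(9) M_simps by (auto simp: breaker_pair_def)
    show "d j = hi M \<or> fwd M (d j)"
      using last[OF j] bp[of j] assms(10) M_simps by (auto simp: breaker_pair_def)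
  qed
  \<comment> \<open>Summing over an index set independent of \<open>i\<close> turns \<open>z\<close>
    into a pointwise sum of sections; the added terms are zero.\<close>
  define w where "w i = (\<Sum>j\<in>{1..r}. y j i)" for i
  have w: "compatible_section M (internal_sum {1..r} J) w"
    unfolding w_def by (rule compatible_section_sum[OF M subm y])
  have wz: "w i = z i" if "i \<in> {p..q}" for i
  proof -
    have "{j. j \<in> {1..r} \<and> i \<in> {b j..d j}} = {1..r} \<inter> {j. i \<in> {b j..d j}}" by auto
    then show ?thesis
      unfolding assms(12)[OF that] w_def y_def
      by (simp only: sum.inter_restrict[OF finite_atLeastAtMost] mem_Collect_eq)
  qed
  have S: "S i = span {w i}" if "i \<in> {lo M..hi M}" for i
    using assms(13)[of i] that wz[of i] by (simp add: M_simps)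
  have sumV: "internal_sum {1..r} J i \<subseteq> vspace M i" if i: "i \<in> {lo M..hi M}" for i
  proof
    fix v assume "v \<in> internal_sum {1..r} J i"
    then obtain c where c: "\<And>j. j \<in> {1..r} \<Longrightarrow> c j \<in> J j i" "v = (\<Sum>j\<in>{1..r}. c j)"
      using internal_sumE by blast
    have "c j \<in> vspace M i" if "j \<in> {1..r}" for j
      using c(1)[OF that] subm[OF that] i by (auto simp: is_submodule_def)
    then show "v \<in> vspace M i"
      using M i unfolding c(2) by (intro subspace_sum) (auto simp: zigzag_module_def)
  qed
  have sumsub: "subspace (internal_sum {1..r} J i)" if "i \<in> {lo M..hi M}" for i
    by (rule subspace_internal_sum[OF vs]) (rule subJ[OF _ that])
  have wV: "compatible_section M (vspace M) w"
    using w sumV unfolding compatible_section_def by blast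
  have yJ: "y j i \<in> J j i" if "j \<in> {1..r}" "i \<in> {lo M..hi M}" for i j
    using y[OF that(1)] that(2) by (simp add: compatible_section_def)
  \<comment> \<open>Some interval of the chain contains \<open>i\<close>. If the sum vanished,
    independence of the \<open>J j\<close> would make the generator of that summand zero.\<close>
  have nz: "w i \<noteq> 0" if i: "i \<in> {lo M..hi M}" for i
  proof
    assume 0: "w i = 0"
    obtain j where j: "j \<in> {1..r}" "i \<in> {b j..d j}"
    proof (rule chain_intervals_cover[of r b d i])
      show "b (Suc j) \<le> d j" if "j \<in> {1..<r}" for j using bp[OF that] by (simp add: breaker_pair_def)
    qed (use r i assms(9,10) M_simps in auto)
    have "y j i = 0"
      using 0 unfolding w_def
      by (intro direct_family_sum_eq_0[OF direct_family_breaker_chain[OF vs dec ch] i, of "\<lambda>j. y j i"])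
        (use j i yJ subspace_0[OF subJ] in auto)
    moreover have "x j i \<noteq> 0" using assms(11)[OF j(1)] j(2) by (simp add: compatible_generators_def)
    ultimately show False using j(2) by (simp add: y_def)
  qed
  have "is_submodule (sub_zigzag M (internal_sum {1..r} J)) S"
    by (rule is_submodule_span_section[OF M sumsub sumV w S])
  moreover have "zigzag_isomorphic (sub_zigzag M S) (interval_module p q (fwd V) p q)"
    using span_section_isomorphic[OF M wV nz S] by (simp add: M_simps)
  moreover have "\<not> inclusion_splits (sub_zigzag M (internal_sum {1..r} J)) S"
  proof
    assume "inclusion_splits (sub_zigzag M (internal_sum {1..r} J)) S"
    then obtain \<rho> where \<rho>: "zigzag_hom (sub_zigzag M (internal_sum {1..r} J)) (sub_zigzag M S) \<rho>"
      and id: "\<And>i v. i \<in> {lo M..hi M} \<Longrightarrow> v \<in> S i \<Longrightarrow> \<rho> i v = v"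
      unfolding inclusion_splits_def by (auto simp: sub_zigzag_def)
    have p: "p \<in> {lo M..hi M}" using assms(5) by (simp add: M_simps)
    have y_sum: "y j i \<in> internal_sum {1..r} J i" if "j \<in> {1..r}" "i \<in> {lo M..hi M}" for i j
    proof -
      \<comment> \<open>The family supported at position \<open>j\<close> places
        \<open>y j i\<close> in the internal sum.\<close>
      have "(\<Sum>k\<in>{1..r}. if k = j then y j i else 0) \<in> internal_sum {1..r} J i"
        by (rule internal_sumI) (use that yJ subspace_0[OF subJ] in auto)
      then show ?thesis using that by (simp add: sum.delta)
    qed
    have "\<rho> p (y j p) = 0" if j: "j \<in> {1..r}" for j
    proof -
      \<comment> \<open>No summand of the chain has full support: the last one starts after its
        predecessor, which exists since \<open>r \<ge> 2\<close>, hence after \<open>p\<close>;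
        every other one ends before its successor does, hence before \<open>q\<close>.\<close>
      have "\<exists>m\<in>{p, q}. m \<notin> {b j..d j}"
      proof (cases "j = r")
        case True
        then have "breaker_pair M (J (j - 1)) (b (j - 1)) (d (j - 1)) (J j) (b j) (d j)"
          using bp[of "j - 1"] r by auto
        then have "p < b j" by (auto simp: breaker_pair_def iso_interval_def M_simps)
        then show ?thesis by simp
      next
        case False
        then have "d j < q" using last[OF j] bp[of j]
          by (auto simp: breaker_pair_def iso_interval_def M_simps)
        then show ?thesis by simp
      qed
      then obtain m where "m \<in> {p, q}" "m \<notin> {b j..d j}" by blast
      then have m: "m \<in> {lo M..hi M}" "y j m = 0"
        using assms(5) by (auto simp: M_simps y_def)
      have yj: "compatible_section M (internal_sum {1..r} J) (y j)"
        using y[OF j] y_sum[OF j] by (simp add: compatible_section_def)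
      show ?thesis
        by (rule hom_to_span_section_kills_vanishing[where y = "y j", OF M wV nz S \<rho> _ yj m p])
          (assumption | rule subspace_0[OF sumsub])+
    qed
    \<comment> \<open>By linearity \<rho> kills \<open>w p\<close>, yet as a retraction it fixes
      this nonzero vector of \<open>S p\<close>.\<close>
    moreover have "\<rho> p (w p) = (\<Sum>j\<in>{1..r}. \<rho> p (y j p))"
      unfolding w_def
    proof (rule linear_between_sum[OF _ vs sumsub[OF p]])
      show "linear_between (scl M) (scl M) (internal_sum {1..r} J p) (S p) (\<rho> p)"
        using \<rho> p by (simp add: zigzag_hom_def sub_zigzag_def)
    qed (rule y_sum[OF _ p])
    moreover have "\<rho> p (w p) = w p" by (rule id[OF p]) (simp add: S[OF p] span_base)
    ultimately show False using nz[OF p] by simp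
  qed
  ultimately show ?thesis unfolding M_def by blast
qed

end
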